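(* For every integer $a\geq 2$, $\mathrm{F}(S(a))=\left\lceil\frac{a-1}{2}\right\rceil l_a-1$.
   Context: $\mathbb{N}=\{0,1,2,\ldots\}$. The Lucas series $\{l_n\}_{n\in\mathbb{N}}$ is defined by $l_0=2$, $l_1=1$, $l_{n+2}=l_{n+1}+l_n$. For $a\in\mathbb{N}$, $S(a)$ is the submonoid of $(\mathbb{N},+)$ generated by $\{l_a\}\cup\{l_a+l_n\mid n\in\mathbb{N}\}$; it is a numerical semigroup, i.e. $\mathbb{N}\setminus S(a)$ is finite. The Frobenius number $\mathrm{F}(S)$ of a numerical semigroup $S$ is the greatest integer not belonging to $S$. *)

theory Defs
  imports Complex_Main
begin

fun lucas :: "nat \<Rightarrow> nat" where
  "lucas 0 = 2"
| "lucas (Suc 0) = 1"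
| "lucas (Suc (Suc n)) = lucas (Suc n) + lucas n"

definition is_submonoid :: "nat set \<Rightarrow> bool" where
  "is_submonoid M \<longleftrightarrow> 0 \<in> M \<and> (\<forall>x\<in>M. \<forall>y\<in>M. x + y \<in> M)"

definition lucas_semigroup :: "nat \<Rightarrow> nat set" where
  "lucas_semigroup a = is_submonoid hull ({lucas a} \<union> {lucas a + lucas n | n. True})"

(* The maximum is over all integers, so frobenius_number UNIV = -1.  If the complement of S in
   the natural numbers is infinite, the value is unspecified. *)
definition frobenius_number :: "nat set \<Rightarrow> int" where
  "frobenius_number S = (GREATEST x. x \<notin> int ` S)"

end

theory Submission
  imports Defs
begin

text \<open>
  An element of \<open>S(a)\<close> has the form \<open>k * l\<^sub>a + y\<close> with \<open>y\<close> a sum of at most \<open>k\<close> Lucas numbers.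
  With \<open>m = a div 2\<close>, every \<open>r < l\<^sub>a\<close> is a sum of at most \<open>m\<close> Lucas numbers, so \<open>S(a)\<close> contains
  everything from \<open>m * l\<^sub>a\<close> on. Conversely, \<open>m * l\<^sub>a - 1\<close> lies in \<open>S(a)\<close> only if \<open>j * l\<^sub>a - 1\<close> is a
  sum of at most \<open>m - j\<close> Lucas numbers for some \<open>j \<ge> 1\<close>. Adding a Lucas number \<open>l\<^sub>i\<close> lengthens the
  greedy Lucas expansion by at most one term and lowers its least index, if that was at most \<open>i\<close>,
  by at most two. Hence greedy expansions are shortest, and \<open>j * l\<^sub>a\<close> has only indices
  \<open>\<ge> a - 2 * (j - 1)\<close>; expanding the last term of \<open>j * l\<^sub>a\<close> minus one shows that the greedy expansion
  of \<open>j * l\<^sub>a - 1\<close> has at least \<open>m - j + 1\<close> terms.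
\<close>

section \<open>Growth of the Lucas numbers\<close>

lemma lucas_pos: "lucas n > 0"
  by (induction n rule: lucas.induct) auto

lemma lucas_ge: "n \<le> lucas n"
proof (induction n rule: lucas.induct)
  case (3 n)
  then show ?case using lucas_pos[of n] by simp
qed auto

lemma lucas_mono:
  assumes "1 \<le> m" "m \<le> n"
  shows "lucas m \<le> lucas n"
  using assms(2,1)
proof (induction rule: dec_induct)
  case (step n)
  then obtain k where "n = Suc k" by (cases n) auto
  with step show ?case by simp
qed simp

text \<open>The only inversion is \<open>lucas 0 > lucas 1\<close>, and \<open>lucas 2 = 3\<close>
  already exceeds both.\<close>

lemma lucas_le: "2 \<le> n \<Longrightarrow> i \<le> n \<Longrightarrow> lucas i \<le> lucas n"
  using lucas_mono[of i n] lucas_mono[of 2 n]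
  by (cases i) (auto simp: numeral_eq_Suc)

text \<open>The greatest \<open>n\<close> with \<open>lucas n \<le> N\<close> exists because
  \<open>n \<le> lucas n\<close>; as \<open>lucas 2 = 3\<close>, it lies beyond the irregular start
  2, 1.\<close>

lemma lucas_ge_2_bounds:
  assumes "N \<ge> 3"
  obtains n where "2 \<le> n" "lucas n \<le> N" "N < lucas (Suc n)"
proof -
  define n where "n = (GREATEST n. lucas n \<le> N)"
  have bd: "\<forall>n. lucas n \<le> N \<longrightarrow> n \<le> N"
    using lucas_ge le_trans by blast
  have two: "lucas 2 \<le> N" using assms by (simp add: numeral_eq_Suc)
  have "lucas n \<le> N" unfolding n_def by (rule GreatestI_nat[where P = "\<lambda>n. lucas n \<le> N", OF two]) (use bd in blast)
  moreover have "2 \<le> n" unfolding n_def by (rule Greatest_le_nat[where P = "\<lambda>n. lucas n \<le> N", OF two]) (use bd in blast)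
  moreover have "N < lucas (Suc n)"
  proof (rule ccontr)
    assume "\<not> N < lucas (Suc n)"
    then have "Suc n \<le> n" unfolding n_def
      by (intro Greatest_le_nat[where b = N]) (use bd in auto)
    then show False by simp
  qed
  ultimately show ?thesis using that by blast
qed

section \<open>Greedy Lucas expansions\<close>

text \<open>\<open>2 = l\<^sub>0\<close> needs its own case because \<open>l\<^sub>0 > l\<^sub>1\<close>: the greatest \<open>n\<close> with \<open>l\<^sub>n \<le> 2\<close> is \<open>1\<close>.\<close>

definition top_index :: "nat \<Rightarrow> nat" where
  "top_index N = (if N = 2 then 0 else (GREATEST n. lucas n \<le> N))"

function digits :: "nat \<Rightarrow> nat list" where
  "digits N = (if N = 0 then [] else top_index N # digits (N - lucas (top_index N)))"
  by pat_completeness auto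
termination
  by (relation "measure id") (use lucas_pos in auto)

declare digits.simps [simp del]

lemma digits_0 [simp]: "digits 0 = []"
  by (simp add: digits.simps)

lemma top_index_eq:
  assumes "1 \<le> n" "lucas n \<le> N" "N < lucas (Suc n)" "N \<noteq> 2"
  shows "top_index N = n"
proof -
  have "(GREATEST n. lucas n \<le> N) = n"
  proof (rule Greatest_equality)
    fix k assume k: "lucas k \<le> N"
    show "k \<le> n"
    proof (rule ccontr)
      assume "\<not> k \<le> n"
      then have "lucas (Suc n) \<le> lucas k" by (intro lucas_mono) auto
      with k assms show False by simp
    qed
  qed (use assms in simp)
  then show ?thesis using assms by (simp add: top_index_def)
qed

text \<open>The bound on \<open>A\<close> keeps the sum below \<open>lucas (n + 3)\<close>, so the
  top index is \<open>n + 2\<close>. Nearly all expansions below are computed with this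
  rule.\<close>

lemma digits_lucas_add:
  assumes "A < lucas (Suc n)"
  shows "digits (lucas (Suc (Suc n)) + A) = Suc (Suc n) # digits A"
proof -
  have "lucas 2 \<le> lucas (Suc (Suc n))" by (rule lucas_mono) auto
  then have "3 \<le> lucas (Suc (Suc n))" by (simp add: numeral_eq_Suc)
  then show ?thesis
    using top_index_eq[of "Suc (Suc n)" "lucas (Suc (Suc n)) + A"] assms
    by (subst digits.simps) auto
qed

lemma digits_lucas [simp]: "digits (lucas n) = [n]"
proof (cases n rule: lucas.cases)
  case 1
  then show ?thesis by (simp add: digits.simps top_index_def)
next
  case 2
  then show ?thesis using top_index_eq[of 1 1] by (simp add: digits.simps)
next
  case (3 k)
  then show ?thesis using digits_lucas_add[of 0 k] lucas_pos by simp
qed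

text \<open>The table reaches \<open>13 = 6 + lucas 4\<close>, the largest sum with
  \<open>N < 7\<close> and \<open>i \<le> 4\<close>.\<close>

lemma digits_small:
  "digits 1 = [1]" "digits 2 = [0]" "digits 3 = [2]" "digits 4 = [3]"
  "digits 5 = [3, 1]" "digits 6 = [3, 0]" "digits 7 = [4]" "digits 8 = [4, 1]"
  "digits 9 = [4, 0]" "digits 10 = [4, 2]" "digits 11 = [5]" "digits 12 = [5, 1]"
  "digits 13 = [5, 0]"
proof -
  show "digits 1 = [1]" and d2: "digits 2 = [0]" and "digits 3 = [2]" and "digits 4 = [3]"
    and "digits 7 = [4]" and "digits 11 = [5]"
    using digits_lucas[of 1] digits_lucas[of 0] digits_lucas[of 2] digits_lucas[of 3]
      digits_lucas[of 4] digits_lucas[of 5]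
    by (simp_all add: numeral_eq_Suc)
  then show "digits 5 = [3, 1]" "digits 6 = [3, 0]" "digits 8 = [4, 1]" "digits 9 = [4, 0]"
    "digits 10 = [4, 2]" "digits 12 = [5, 1]" "digits 13 = [5, 0]"
    using digits_lucas_add[of 1 1] digits_lucas_add[of 2 1] digits_lucas_add[of 1 2]
      digits_lucas_add[of 2 2] digits_lucas_add[of 3 2] digits_lucas_add[of 1 3]
      digits_lucas_add[of 2 3]
    by (simp_all add: numeral_eq_Suc)
qed

section \<open>Adding one Lucas number to an expansion\<close>

definition digits_ge :: "nat \<Rightarrow> nat \<Rightarrow> bool" where
  "digits_ge b N \<longleftrightarrow> (\<forall>x\<in>set (digits N). b \<le> x)"

text \<open>Lower bounds \<open>b\<close> replace the least index so that \<open>N = 0\<close>, with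
  its empty expansion, is covered too.\<close>

definition adds_well :: "nat \<Rightarrow> nat \<Rightarrow> bool" where
  "adds_well N i \<longleftrightarrow> length (digits (N + lucas i)) \<le> Suc (length (digits N)) \<and>
     (\<forall>b. digits_ge b N \<longrightarrow> b \<le> i \<longrightarrow> digits_ge (b - 2) (N + lucas i))"

lemma adds_well_below:
  assumes "2 \<le> i" "N < lucas (i - 1)"
  shows "adds_well N i"
proof -
  define k where "k = i - 2"
  have i: "i = Suc (Suc k)" using assms by (simp add: k_def)
  have "digits (N + lucas i) = i # digits N"
    using digits_lucas_add[of N k] assms by (simp add: i add.commute)
  then show ?thesis by (auto simp: adds_well_def digits_ge_def intro: le_trans[OF diff_le_self])
qed

text \<open>From \<open>lucas 4 = 7\<close> on, the leading index \<open>n\<close> satisfies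
  \<open>n - 2 \<ge> 2\<close>, as the general step requires. Below that, small \<open>i\<close> are
  checked by table, and \<open>i \<ge> 5\<close> is simply prepended.\<close>

lemma adds_well_small:
  assumes "N < 7"
  shows "adds_well N i"
proof (cases "i \<le> 4")
  case True
  have "N \<in> {0,1,2,3,4,5,6}" "i \<in> {0,1,2,3,4}" using assms True by auto
  moreover have "lucas 2 = 3" "lucas 3 = 4" "lucas 4 = 7" by (simp_all add: numeral_eq_Suc)
  ultimately show ?thesis
    using digits_small digits_small(2)[unfolded numeral_2_eq_2] digits_small(3)[unfolded numeral_3_eq_3]
    by (auto simp: adds_well_def digits_ge_def)
next
  case False
  then have "lucas 4 \<le> lucas (i - 1)" by (intro lucas_mono) auto
  then show ?thesis using assms False by (intro adds_well_below) (auto simp: numeral_eq_Suc)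
qed

lemma adds_well: "adds_well N i"
proof (induction N arbitrary: i rule: less_induct)
  case (less N)
  show ?case
  proof (cases "N < 7")
    case True
    then show ?thesis by (rule adds_well_small)
  next
    case False
    then obtain n where n: "2 \<le> n" "lucas n \<le> N" "N < lucas (Suc n)"
      using lucas_ge_2_bounds[of N] by auto
    have "4 \<le> n"
    proof (rule ccontr)
      assume "\<not> 4 \<le> n"
      then have "lucas (Suc n) \<le> lucas 4" by (intro lucas_mono) auto
      with n False show False by (simp add: numeral_eq_Suc)
    qed
    define m where "m = n - 2"
    have m: "n = Suc (Suc m)" "2 \<le> m" using \<open>4 \<le> n\<close> by (auto simp: m_def)
    define A where "A = N - lucas n"
    have N: "N = lucas n + A" using n A_def by simp
    have A: "A < lucas (Suc m)" using n by (simp add: N m)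
    have dN: "digits N = n # digits A" using digits_lucas_add[OF A] by (simp add: N m)
    have IH: "adds_well A j" for j using less[of A] lucas_pos[of n] by (simp add: N)
    have mm: "lucas m \<le> lucas (Suc m)" using m by (intro lucas_mono) auto
    \<comment> \<open>Small \<open>i\<close> recurse into the remainder \<open>A\<close>;
      \<open>n - 1\<close> and \<open>n + 1\<close> merge with \<open>lucas n\<close> into a single
      Lucas number; \<open>i \<ge> n + 2\<close> is prepended.\<close>
    consider "i \<le> m" | "i = Suc m" | "i = n" | "i = Suc n" | "i \<ge> Suc (Suc n)"
      using m by linarith
    then show ?thesis
    proof cases
      case 1
      then have li: "lucas i \<le> lucas m" using m by (intro lucas_le) auto
      show ?thesis
      proof (cases "A + lucas i < lucas (Suc m)")
        case True
        have "digits (N + lucas i) = n # digits (A + lucas i)"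
          using digits_lucas_add[OF True] by (simp add: N m add.assoc)
        then show ?thesis using IH[of i] dN
          by (auto simp: adds_well_def digits_ge_def intro: le_trans[OF diff_le_self])
      next
        case False
        \<comment> \<open>Carry: \<open>A + lucas i\<close> contains \<open>lucas (n - 1)\<close>,
          which merges with \<open>lucas n\<close> into \<open>lucas (n + 1)\<close>. The rest
          \<open>R\<close> keeps the index bound known for \<open>A + lucas i\<close>.\<close>
        define R where "R = A + lucas i - lucas (Suc m)"
        have R: "A + lucas i = lucas (Suc m) + R" using False R_def by simp
        have Rm: "R < lucas m" using A li R by linarith
        obtain l where l: "m = Suc l" using m by (cases m) auto
        have d1: "digits (A + lucas i) = Suc m # digits R"
          using digits_lucas_add[of R l] Rm by (simp add: R l)
        have "N + lucas i = lucas (Suc n) + R" using R by (simp add: N m)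
        then have d2: "digits (N + lucas i) = Suc n # digits R"
          using digits_lucas_add[of R "Suc m"] Rm mm by (simp add: m)
        show ?thesis using IH[of i] dN d1 d2 m(1)
          by (auto simp: adds_well_def digits_ge_def)
      qed
    next
      case 2
      have "digits (N + lucas i) = Suc n # digits A"
        using digits_lucas_add[of A "Suc m"] A by (simp add: N m 2 algebra_simps)
      then show ?thesis using dN
        by (auto simp: adds_well_def digits_ge_def intro: le_trans[OF diff_le_self])
    next
      case 3
      \<comment> \<open>\<open>2 l\<^sub>n = l\<^sub>n\<^sub>+\<^sub>1 + l\<^sub>n\<^sub>-\<^sub>2\<close>; the only step that lowers the least index\<close>
      have "digits (N + lucas i) = Suc n # digits (A + lucas m)"
        using digits_lucas_add[of "A + lucas m" "Suc m"] A by (simp add: N m 3 algebra_simps)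
      moreover have "digits_ge (b - 2) (A + lucas m)" if b: "digits_ge b A" "b \<le> n" for b
      proof (cases "b \<le> m")
        case True
        then show ?thesis using IH[of m] b by (simp add: adds_well_def)
      next
        case False
        \<comment> \<open>An expansion of \<open>A > 0\<close> with all indices at least
          \<open>b > n - 2\<close> would give \<open>lucas (n - 1) \<le> A\<close>.\<close>
        have "A = 0"
        proof (rule ccontr)
          assume "A \<noteq> 0"
          then have x: "top_index A \<in> set (digits A)" by (subst digits.simps) simp
          then have bx: "b \<le> top_index A" using b by (simp add: digits_ge_def)
          show False
          proof (cases "A < 3")
            case True
            then have "A = 1 \<or> A = 2" using \<open>A \<noteq> 0\<close> by auto
            then show False using bx x False m digits_small by auto
          next
            case A3: False
            then obtain k where k: "2 \<le> k" "lucas k \<le> A" "A < lucas (Suc k)"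
              using lucas_ge_2_bounds[of A] by auto
            then have "top_index A = k" using A3 by (intro top_index_eq) auto
            then have "Suc m \<le> k" using bx False by simp
            then have "lucas (Suc m) \<le> lucas k" by (intro lucas_mono) auto
            then show False using k A by simp
          qed
        qed
        then show ?thesis using b m by (simp add: digits_ge_def)
      qed
      ultimately show ?thesis using IH[of m] dN 3 by (auto simp: adds_well_def digits_ge_def)
    next
      case 4
      have "digits (N + lucas i) = Suc (Suc n) # digits A"
        using digits_lucas_add[of A n] A by (simp add: N m 4 algebra_simps)
      then show ?thesis using dN
        by (auto simp: adds_well_def digits_ge_def intro: le_trans[OF diff_le_self])
    next
      case 5
      then have "lucas (Suc n) \<le> lucas (i - 1)" by (intro lucas_mono) auto
      then show ?thesis using n 5 by (intro adds_well_below) auto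
    qed
  qed
qed

section \<open>Bounds on the number of Lucas summands\<close>

lemma length_digits_sum_list: "length (digits (sum_list (map lucas xs))) \<le> length xs"
proof (induction xs)
  case (Cons x xs)
  then show ?case using adds_well[of "sum_list (map lucas xs)" x]
    by (simp add: adds_well_def add.commute)
qed simp

text \<open>Starting from the single index \<open>a\<close>, each further copy of
  \<open>lucas a\<close> lowers the bound by at most two.\<close>

lemma digits_ge_mult: "digits_ge (a - 2 * j) (Suc j * lucas a)"
proof (induction j)
  case 0
  then show ?case by (simp add: digits_ge_def)
next
  case (Suc j)
  have "digits_ge (a - 2 * j - 2) (Suc j * lucas a + lucas a)"
    using adds_well[of "Suc j * lucas a" a] Suc by (simp only: adds_well_def)
  then show ?case by (simp add: algebra_simps)
qed

text \<open>By \<open>lucas (n + 2) - 1 = lucas (n + 1) + (lucas n - 1)\<close>, two indices cost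
  one term. Even indices end at \<open>lucas 2 - 1 = lucas 0\<close>, since
  \<open>lucas 0 - 1 = 1\<close> still has one term.\<close>

lemma length_digits_lucas_pred: "1 \<le> n \<Longrightarrow> length (digits (lucas n - 1)) = n div 2"
proof (induction n rule: lucas.induct)
  case (3 n)
  show ?case
  proof (cases n)
    case 0
    then show ?thesis using digits_small by (simp add: numeral_eq_Suc)
  next
    case (Suc k)
    have "lucas (Suc (Suc n)) - 1 = lucas (Suc n) + (lucas n - 1)"
      using lucas_pos[of n] by simp
    moreover have "digits (lucas (Suc n) + (lucas n - 1)) = Suc n # digits (lucas n - 1)"
      using digits_lucas_add[of "lucas n - 1" k] lucas_pos[of n] unfolding Suc by simp
    ultimately have "length (digits (lucas (Suc (Suc n)) - 1)) = Suc (length (digits (lucas n - 1)))"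
      by (simp only: list.size)
    then show ?thesis using 3(2) Suc by simp
  qed
qed auto

text \<open>Subtracting 1 leaves all terms but the last untouched; the last is
  \<open>lucas c\<close> with \<open>c \<ge> b\<close>, and \<open>lucas c - 1\<close> has at least
  \<open>c div 2\<close> terms.\<close>

lemma length_digits_pred:
  assumes "N > 0" "digits_ge b N"
  shows "b div 2 \<le> length (digits (N - 1))"
  using assms
proof (induction N rule: less_induct)
  case (less N)
  show ?case
  proof (cases "N < 3")
    case True
    then have "N = 1 \<or> N = 2" using less by auto
    then show ?thesis using less digits_small by (auto simp: digits_ge_def)
  next
    case False
    then obtain n where n: "2 \<le> n" "lucas n \<le> N" "N < lucas (Suc n)"
      using lucas_ge_2_bounds[of N] by auto
    define m where "m = n - 2"
    have m: "n = Suc (Suc m)" using n by (simp add: m_def)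
    define A where "A = N - lucas n"
    have N: "N = lucas n + A" using n A_def by simp
    have A: "A < lucas (Suc m)" using n by (simp add: N m)
    have dN: "digits N = n # digits A" using digits_lucas_add[OF A] by (simp add: N m)
    show ?thesis
    proof (cases "A = 0")
      case True
      then show ?thesis using length_digits_lucas_pred[of n] n less.prems dN
        by (simp add: N digits_ge_def div_le_mono)
    next
      case False
      have "N - 1 = lucas n + (A - 1)" using False by (simp add: N)
      then have "digits (N - 1) = n # digits (A - 1)"
        using digits_lucas_add[of "A - 1" m] A by (simp add: m)
      moreover have "b div 2 \<le> length (digits (A - 1))"
        using less.prems dN False lucas_pos[of n] by (intro less.IH) (auto simp: N digits_ge_def)
      ultimately show ?thesis by simp
    qed
  qed
qed

text \<open>If \<open>r \<ge> lucas (a - 1)\<close>, removing that term leaves less than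
  \<open>lucas (a - 2)\<close>, so one summand pays for two indices.\<close>

lemma lucas_sum_of_less:
  assumes "2 \<le> a" "r < lucas a"
  shows "\<exists>xs. length xs \<le> a div 2 \<and> sum_list (map lucas xs) = r"
  using assms
proof (induction a arbitrary: r rule: less_induct)
  case (less a)
  show ?case
  proof (cases "a \<le> 3")
    case True
    then have "a = 2 \<or> a = 3" using less.prems by auto
    then have "r < 4" using less.prems by (auto simp: numeral_eq_Suc)
    have d: "a div 2 = 1" using \<open>a = 2 \<or> a = 3\<close> by auto
    then have "r = 0 \<or> r = lucas 1 \<or> r = lucas 0 \<or> r = lucas 2"
      using \<open>r < 4\<close> by (auto simp: numeral_eq_Suc)
    then have "r = 0 \<or> (\<exists>i. r = lucas i)" by blast
    then show ?thesis
    proof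
      assume "r = 0"
      then show ?thesis by (intro exI[of _ "[]"]) simp
    next
      assume "\<exists>i. r = lucas i"
      then obtain i where "r = lucas i" ..
      then show ?thesis using d by (intro exI[of _ "[i]"]) simp
    qed
  next
    case False
    define n where "n = a - 2"
    have a: "a = Suc (Suc n)" "2 \<le> n" using False by (auto simp: n_def)
    show ?thesis
    proof (cases "r < lucas (Suc n)")
      case True
      then obtain xs where "length xs \<le> Suc n div 2" "sum_list (map lucas xs) = r"
        using less.IH[of "Suc n" r] a by auto
      moreover have "Suc n div 2 \<le> a div 2" using a by (intro div_le_mono) simp
      ultimately show ?thesis using le_trans by blast
    next
      case False
      then have "r - lucas (Suc n) < lucas n" using less.prems a by auto
      then obtain xs where "length xs \<le> n div 2" "sum_list (map lucas xs) = r - lucas (Suc n)"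
        using less.IH[of n] a by auto
      then show ?thesis using False a by (intro exI[of _ "Suc n # xs"]) auto
    qed
  qed
qed

section \<open>The semigroup \<open>S(a)\<close> and its Frobenius number\<close>

text \<open>\<open>k\<close> counts the generators used; each contributes \<open>lucas a\<close> and
  at most one further Lucas number.\<close>

lemma lucas_semigroup_eq:
  "lucas_semigroup a =
     {k * lucas a + sum_list (map lucas xs) | k xs. length xs \<le> k}" (is "_ = ?T")
proof
  have "is_submonoid ?T"
    unfolding is_submonoid_def
  proof (intro conjI ballI)
    show "0 \<in> ?T" by (auto intro!: exI[of _ 0] exI[of _ "[]"])
  next
    fix x y assume "x \<in> ?T" "y \<in> ?T"
    then obtain k xs l ys where
      "x = k * lucas a + sum_list (map lucas xs)" "length xs \<le> k"
      "y = l * lucas a + sum_list (map lucas ys)" "length ys \<le> l" by blast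
    then have "x + y = (k + l) * lucas a + sum_list (map lucas (xs @ ys))"
      "length (xs @ ys) \<le> k + l" by (auto simp: algebra_simps)
    then show "x + y \<in> ?T" by blast
  qed
  moreover have "lucas a \<in> ?T" by (auto intro!: exI[of _ 1] exI[of _ "[]"])
  moreover have "lucas a + lucas n \<in> ?T" for n
  proof -
    have "lucas a + lucas n = 1 * lucas a + sum_list (map lucas [n])" "length [n] \<le> 1" by auto
    then show ?thesis by blast
  qed
  ultimately show "lucas_semigroup a \<subseteq> ?T"
    unfolding lucas_semigroup_def by (intro hull_minimal) auto
next
  let ?G = "{lucas a} \<union> {lucas a + lucas n | n. True}"
  \<comment> \<open>Submonoids are closed under intersection.\<close>
  have "is_submonoid (is_submonoid hull ?G)"
    unfolding hull_def is_submonoid_def by blast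
  then have zero: "0 \<in> lucas_semigroup a"
    and add: "\<And>x y. x \<in> lucas_semigroup a \<Longrightarrow> y \<in> lucas_semigroup a \<Longrightarrow> x + y \<in> lucas_semigroup a"
    unfolding lucas_semigroup_def is_submonoid_def by blast+
  have gen: "lucas a \<in> lucas_semigroup a" "lucas a + lucas n \<in> lucas_semigroup a" for n
    unfolding lucas_semigroup_def by (auto intro!: hull_inc)
  have "k * lucas a + sum_list (map lucas xs) \<in> lucas_semigroup a" if "length xs \<le> k" for k xs
    using that
  proof (induction k arbitrary: xs)
    case 0
    then show ?case using zero by simp
  next
    case (Suc k)
    show ?case
    proof (cases xs)
      case Nil
      then show ?thesis using add[OF gen(1) Suc.IH[of "[]"]] by (simp add: algebra_simps)
    next
      case (Cons y ys)
      then show ?thesis using add[OF gen(2)[of y] Suc.IH[of ys]] Suc.prems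
        by (simp add: algebra_simps)
    qed
  qed
  then show "?T \<subseteq> lucas_semigroup a" by blast
qed

text \<open>Division by \<open>lucas a\<close>: the quotient is at least \<open>a div 2\<close>,
  enough to absorb the Lucas summands of the remainder.\<close>

lemma mem_lucas_semigroup:
  assumes "2 \<le> a" "(a div 2) * lucas a \<le> N"
  shows "N \<in> lucas_semigroup a"
proof -
  obtain xs where xs: "length xs \<le> a div 2" "sum_list (map lucas xs) = N mod lucas a"
    using lucas_sum_of_less[OF assms(1), of "N mod lucas a"] lucas_pos[of a] by auto
  have "a div 2 \<le> N div lucas a"
    using assms(2) lucas_pos[of a] by (simp add: less_eq_div_iff_mult_less_eq)
  then have "length xs \<le> N div lucas a" using xs by simp
  moreover have "N = N div lucas a * lucas a + sum_list (map lucas xs)" using xs by simp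
  ultimately show ?thesis unfolding lucas_semigroup_eq by blast
qed

lemma not_mem_lucas_semigroup:
  assumes "2 \<le> a"
  shows "(a div 2) * lucas a - 1 \<notin> lucas_semigroup a"
proof
  define m where "m = a div 2"
  have m: "m > 0" using assms by (simp add: m_def div_greater_zero_iff)
  assume "(a div 2) * lucas a - 1 \<in> lucas_semigroup a"
  then obtain k xs where
    eq: "m * lucas a - 1 = k * lucas a + sum_list (map lucas xs)" and len: "length xs \<le> k"
    unfolding lucas_semigroup_eq m_def by blast
  have pos: "m * lucas a > 0" using m lucas_pos by simp
  have "k < m"
  proof (rule ccontr)
    assume "\<not> k < m"
    then have "m * lucas a \<le> k * lucas a" by simp
    with eq pos show False by linarith
  qed
  \<comment> \<open>\<open>xs\<close> must sum to \<open>(j + 1) * lucas a - 1\<close> with at most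
    \<open>k = m - j - 1\<close> terms, one fewer than the lower bound
    \<open>(a - 2 * j) div 2 = m - j\<close>.\<close>
  define j where "j = m - Suc k"
  have j: "m = k + Suc j" using \<open>k < m\<close> by (simp add: j_def)
  have "m * lucas a = k * lucas a + Suc j * lucas a"
    unfolding j by (rule add_mult_distrib)
  then have "sum_list (map lucas xs) = Suc j * lucas a - 1"
    using eq lucas_pos[of a] by simp
  then have "length (digits (Suc j * lucas a - 1)) \<le> k"
    using length_digits_sum_list[of xs] len by simp
  moreover have "(a - 2 * j) div 2 \<le> length (digits (Suc j * lucas a - 1))"
    by (rule length_digits_pred) (use lucas_pos digits_ge_mult in auto)
  moreover have "(a - 2 * j) div 2 = m - j" by (simp add: m_def)
  ultimately show False using j by simp
qed

theorem theorem5p6: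
  fixes a :: nat
  assumes "a \<ge> 2"
  shows "frobenius_number (lucas_semigroup a) = \<lceil>(real a - 1) / 2\<rceil> * int (lucas a) - 1"
proof -
  define m where "m = a div 2"
  \<comment> \<open>\<open>a = 2 * m\<close> gives \<open>m - 1/2\<close> and
    \<open>a = 2 * m + 1\<close> gives \<open>m\<close>; both round up to \<open>m\<close>.\<close>
  have ceil: "\<lceil>(real a - 1) / 2\<rceil> = int m"
  proof (rule ceiling_unique)
    have "a = 2 * m \<or> a = 2 * m + 1" unfolding m_def by presburger
    then show "real_of_int (int m) - 1 < (real a - 1) / 2" "(real a - 1) / 2 \<le> real_of_int (int m)"
      by auto
  qed
  have "m * lucas a > 0" using assms lucas_pos[of a] by (simp add: m_def div_greater_zero_iff)
  then have eq: "int m * int (lucas a) - 1 = int (m * lucas a - 1)"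
    by (simp add: of_nat_diff)
  have "frobenius_number (lucas_semigroup a) = int m * int (lucas a) - 1"
    unfolding frobenius_number_def
  proof (rule Greatest_equality)
    show "int m * int (lucas a) - 1 \<notin> int ` lucas_semigroup a"
      using not_mem_lucas_semigroup[OF assms] unfolding eq by (auto simp: m_def)
  next
    fix y assume y: "y \<notin> int ` lucas_semigroup a"
    show "y \<le> int m * int (lucas a) - 1"
    proof (rule ccontr)
      assume "\<not> ?thesis"
      \<comment> \<open>This makes \<open>y\<close> nonnegative, hence a natural number.\<close>
      then have le: "int (m * lucas a) \<le> y" by simp
      then have "nat y \<in> lucas_semigroup a"
        using assms nat_mono[OF le] by (intro mem_lucas_semigroup) (simp_all only: m_def nat_int)
      moreover have "y = int (nat y)" using order_trans[OF of_nat_0_le_iff le] by simp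
      ultimately show False using y by blast
    qed
  qed
  then show ?thesis by (simp add: ceil)
qed

end
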